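(* Let $A\in\mathbb{R}^{n\times n}$ be symmetric positive semidefinite, let $p\ge1$, let $(w_j)_{j\ge1}$ be a sequence of independent standard Gaussian random vectors in $\mathbb{R}^n$, and for $M\ge1$ let $X_M=\left(\frac1M\sum_{j=1}^M w_j^TA^pw_j\right)^{1/p}$. Then $$\lim_{M\to\infty}X_M=\|A\|_{S_p}\quad\text{almost surely.}$$
   Context: For a symmetric positive semidefinite matrix $A\in\mathbb{R}^{n\times n}$ with eigenvalues $\lambda_1,\dots,\lambda_n\ge 0$ and $p\ge1$, the Schatten $p$-norm is $\|A\|_{S_p}=\big(\sum_{j=1}^n\lambda_j^p\big)^{1/p}=(\operatorname{tr}(A^p))^{1/p}$, where $A^p$ is defined through the spectral decomposition. The samples $w_j:\Omega\to\mathbb{R}^n$ are independent random vectors on a probability space $(\Omega,\mathcal{F},\mathbb{P})$ whose entries are independent standard normal random variables. *)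

theory Defs
  imports
    "HOL-Probability.Probability"
    "HOL-Computational_Algebra.Polynomial"
begin

definition pos_semidef :: "real^'n^'n \<Rightarrow> bool" where
  "pos_semidef A \<longleftrightarrow> transpose A = A \<and> (\<forall>x. 0 \<le> x \<bullet> (A *v x))"

definition diag_matrix :: "real^'n \<Rightarrow> real^'n^'n" where
  "diag_matrix d = (\<chi> i j. if i = j then d $ i else 0)"

definition spectral_decomp :: "real^'n^'n \<Rightarrow> real^'n^'n \<Rightarrow> real^'n \<Rightarrow> bool" where
  "spectral_decomp A U d \<longleftrightarrow>
     orthogonal_matrix U \<and> A = U ** diag_matrix d ** transpose U"

(* A spectral decomposition exists exactly for symmetric A, and the matrix B below does not
   depend on which one is used, so the description is proper for symmetric A.
   For positive semidefinite A and p > 0 the entries of d are nonnegative, and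
   0 powr p = 0 is the intended value. *)
definition matrix_powr :: "real^'n^'n \<Rightarrow> real \<Rightarrow> real^'n^'n" where
  "matrix_powr A p =
     (THE B. \<exists>U d. spectral_decomp A U d \<and>
        B = U ** diag_matrix (\<chi> i. (d $ i) powr p) ** transpose U)"

(* det (x I - A), computed over the polynomial ring *)
definition charpoly :: "real^'n^'n \<Rightarrow> real poly" where
  "charpoly A = det (mat [:0, 1:] - (\<chi> i j. [:A $ i $ j:]))"

(* The sum over the n eigenvalues listed with multiplicity is written as a sum over
   the distinct roots of the characteristic polynomial, weighted by their multiplicity.
   Meant for positive semidefinite A only. *)
definition schatten_norm :: "real \<Rightarrow> real^'n^'n \<Rightarrow> real" where
  "schatten_norm p A =
     (\<Sum>x | poly (charpoly A) x = 0. real (order x (charpoly A)) * x powr p) powr (1 / p)"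

definition (in prob_space) std_gaussian_vector :: "('a \<Rightarrow> real^'n) \<Rightarrow> bool" where
  "std_gaussian_vector X \<longleftrightarrow>
     indep_vars (\<lambda>_. borel) (\<lambda>i \<omega>. X \<omega> $ i) UNIV \<and>
     (\<forall>i. distributed M lborel (\<lambda>\<omega>. X \<omega> $ i) std_normal_density)"

end

(* By the spectral theorem A = U diag(d) U^T, so the Schatten norm is (tr A^p)^(1/p).  The variables
   w_j^T A^p w_j are independent with mean tr A^p, uniformly bounded second moments and, since A^p
   is positive semidefinite, nonnegative values.  Hence the strong law of large numbers is available
   in an elementary form and gives the claim after taking the continuous 1/p-th power. *)
theory Submission
  imports Defs "HOL-Library.Discrete_Functions" "HOL-Real_Asymp.Real_Asymp"
begin

section \<open>Spectral theorem for self-adjoint maps on a Euclidean space\<close>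

text \<open>The quadratic form \<open>x \<bullet> f x\<close> attains its maximum \<open>c\<close>
  on the compact unit sphere of \<open>S\<close>. First-order optimality at a maximiser
  \<open>v\<close> makes \<open>c *\<^sub>R v - f v\<close> orthogonal to \<open>S\<close>, and
  invariance puts this vector into \<open>S\<close>, so it is zero.\<close>

lemma selfadjoint_eigenvector_in_subspace:
  fixes f :: "'a::euclidean_space \<Rightarrow> 'a"
  assumes f: "linear f" and sa: "\<And>x y. x \<bullet> f y = f x \<bullet> y"
    and S: "subspace S" and inv: "f ` S \<subseteq> S" and nz: "S \<noteq> {0}"
  obtains v c where "v \<in> S" "norm v = 1" "f v = c *\<^sub>R v"
proof -
  let ?K = "sphere 0 1 \<inter> S"
  obtain u where u: "u \<in> S" "u \<noteq> 0"
    using nz S subspace_0 by blast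
  then have "u /\<^sub>R norm u \<in> ?K"
    using S by (simp add: subspace_scale)
  then have "?K \<noteq> {}"
    by blast
  moreover have "compact ?K"
    by (intro compact_Int_closed closed_subspace S) simp
  moreover have "continuous_on ?K (\<lambda>x. x \<bullet> f x)"
    by (intro continuous_intros linear_continuous_on linear_conv_bounded_linear[THEN iffD1] f)
  ultimately obtain v where v: "v \<in> S" "norm v = 1"
    and max: "\<And>y. y \<in> S \<Longrightarrow> norm y = 1 \<Longrightarrow> y \<bullet> f y \<le> v \<bullet> f v"
    using continuous_attains_sup[of ?K "\<lambda>x. x \<bullet> f x"]
    by (metis Int_iff mem_sphere_0)
  define c where "c = v \<bullet> f v"
  \<comment> \<open>The gap to the maximal value, made homogeneous: a quadratic form that is
    nonnegative on \<open>S\<close> and vanishes at \<open>v\<close>. Its expansion along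
    \<open>v + t *\<^sub>R u\<close> has linear coefficient \<open>2 * b\<close>, which minimality
    at \<open>t = 0\<close> forces to vanish.\<close>
  define g where "g y = c * (y \<bullet> y) - y \<bullet> f y" for y
  have g_nonneg: "g y \<ge> 0" if "y \<in> S" for y
  proof (cases "y = 0")
    case False
    let ?y = "y /\<^sub>R norm y"
    have "?y \<bullet> f ?y \<le> c"
      using max[of ?y] that S False by (simp add: subspace_scale c_def)
    then have "(y \<bullet> f y) / (norm y)\<^sup>2 \<le> c"
      by (simp add: linear_scale[OF f] power2_eq_square field_simps)
    then show ?thesis
      using False by (simp add: g_def power2_norm_eq_inner field_simps)
  qed (simp add: g_def)
  have orth: "u \<bullet> (c *\<^sub>R v - f v) = 0" if u: "u \<in> S" for u
  proof -
    define b where "b = u \<bullet> (c *\<^sub>R v - f v)"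
    have quad: "0 \<le> 2 * t * b + t\<^sup>2 * g u" for t
    proof -
      have "g v = 0"
        using v by (simp add: g_def c_def norm_eq_1)
      moreover have "v \<bullet> f u = u \<bullet> f v"
        by (metis sa inner_commute)
      ultimately have "g (v + t *\<^sub>R u) = 2 * t * b + t\<^sup>2 * g u"
        by (simp add: g_def b_def linear_add[OF f] linear_scale[OF f] inner_simps
            inner_commute[of v u] power2_eq_square algebra_simps)
      then show ?thesis
        using g_nonneg[of "v + t *\<^sub>R u"] S u v by (simp add: subspace_add subspace_scale)
    qed
    show "b = 0"
    proof (rule ccontr)
      assume "b \<noteq> 0"
      \<comment> \<open>The natural minimiser \<open>- b / g u\<close> breaks down if
        \<open>g u = 0\<close>; adding 1 keeps the denominator positive and the value still
        negative.\<close>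
      define h where "h = g u + 1"
      have h: "h \<ge> 1" "g u = h - 1"
        using g_nonneg[OF u] by (auto simp: h_def)
      have "0 \<le> 2 * (- b / h) * b + (- b / h)\<^sup>2 * g u"
        by (rule quad)
      also have "\<dots> = - (b\<^sup>2 * (h + 1) / h\<^sup>2)"
        using h(1) by (simp add: h(2) field_simps power2_eq_square)
      also have "\<dots> < 0"
        using h \<open>b \<noteq> 0\<close> by simp
      finally show False
        by simp
    qed
  qed
  have "c *\<^sub>R v - f v \<in> S"
    using S v inv by (auto intro!: subspace_diff subspace_scale)
  from orth[OF this] have "f v = c *\<^sub>R v"
    by simp
  with v that show thesis
    by blast
qed

text \<open>An orthonormal set of eigenvectors of maximal cardinality must be a basis: otherwise its
  orthogonal complement is nonzero and, by self-adjointness, invariant, so it supplies one more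
  eigenvector.\<close>

lemma selfadjoint_orthonormal_eigenbasis:
  fixes f :: "'a::euclidean_space \<Rightarrow> 'a"
  assumes f: "linear f" and sa: "\<And>x y. x \<bullet> f y = f x \<bullet> y"
  obtains B where "pairwise orthogonal B" "card B = DIM('a)" "finite B"
    "\<And>b. b \<in> B \<Longrightarrow> norm b = 1" "\<And>b. b \<in> B \<Longrightarrow> \<exists>c. f b = c *\<^sub>R b"
proof -
  define Q where "Q B \<longleftrightarrow> pairwise orthogonal B \<and> (\<forall>b\<in>B. norm b = 1 \<and> (\<exists>c. f b = c *\<^sub>R b))" for B
  have bound: "finite B \<and> card B \<le> DIM('a)" if "Q B" for B
  proof -
    have "0 \<notin> B" "pairwise orthogonal B"
      using that by (auto simp: Q_def)
    then show ?thesis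
      using pairwise_orthogonal_independent independent_bound by blast
  qed
  have "Q {}"
    by (simp add: Q_def)
  then have "\<exists>B. Q B \<and> (\<forall>B'. Q B' \<longrightarrow> card B' \<le> card B)"
    using bound by (intro ex_has_greatest_nat[where b = "Suc DIM('a)"]) (auto simp: less_Suc_eq_le)
  then obtain B where B: "Q B" and max: "\<And>B'. Q B' \<Longrightarrow> card B' \<le> card B"
    by blast
  have "card B = DIM('a)"
  proof (rule ccontr)
    assume "card B \<noteq> DIM('a)"
    then have "dim B < DIM('a)"
      using bound[OF B] dim_le_card'[of B] by linarith
    then obtain x where x: "x \<noteq> 0" "\<And>y. y \<in> span B \<Longrightarrow> orthogonal x y"
      using orthogonal_to_subspace_exists by blast
    define S where "S = {x. \<forall>b\<in>B. b \<bullet> x = 0}"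
    have "subspace S"
      by (auto simp: S_def subspace_def inner_simps)
    moreover have "f ` S \<subseteq> S"
    proof
      fix y assume "y \<in> f ` S"
      then obtain z where z: "y = f z" "z \<in> S"
        by blast
      have "b \<bullet> f z = 0" if "b \<in> B" for b
      proof -
        have "\<exists>c. f b = c *\<^sub>R b"
          using B that by (simp add: Q_def)
        then obtain c where "f b = c *\<^sub>R b"
          by (elim exE)
        with z that show ?thesis
          by (simp add: sa S_def)
      qed
      with z show "y \<in> S"
        by (simp add: S_def)
    qed
    moreover have "x \<in> S"
      using x(2) by (auto simp: S_def orthogonal_def inner_commute span_base)
    ultimately obtain v c where v: "v \<in> S" "norm v = 1" "f v = c *\<^sub>R v"
      using selfadjoint_eigenvector_in_subspace[OF f sa, of S] x(1) by blast
    have "v \<notin> B"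
      using v by (auto simp: S_def norm_eq_1)
    moreover have "Q (insert v B)"
      using B v by (auto simp: Q_def S_def pairwise_insert orthogonal_def inner_commute)
    ultimately show False
      using max[of "insert v B"] bound[OF B] by simp
  qed
  with B bound[OF B] that show thesis
    by (auto simp: Q_def)
qed

section \<open>Spectral decompositions and real powers of matrices\<close>

lemma matrix_mul_diag: "(M ** diag_matrix d) $ i $ j = M $ i $ j * d $ j"
  by (simp add: matrix_matrix_mult_def diag_matrix_def if_distrib cong: if_cong)

lemma diag_mul_matrix: "(diag_matrix d ** M) $ i $ j = d $ i * M $ i $ j"
  by (simp add: matrix_matrix_mult_def diag_matrix_def if_distrib[of "\<lambda>x. x * _"] cong: if_cong)

text \<open>An orthonormal eigenbasis, indexed by \<open>'n\<close> through a bijection, forms the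
  columns of \<open>U\<close>; the eigenvector equations then read
  \<open>A ** U = U ** diag_matrix d\<close>.\<close>

lemma spectral_decomp_exists:
  fixes A :: "real^'n^'n"
  assumes "transpose A = A"
  obtains U d where "spectral_decomp A U d"
proof -
  have sa: "x \<bullet> (A *v y) = (A *v x) \<bullet> y" for x y
    by (metis assms dot_lmul_matrix transpose_matrix_vector)
  obtain B where B: "pairwise orthogonal B" "card B = DIM(real^'n)" "finite B"
    and unit: "\<And>b. b \<in> B \<Longrightarrow> norm b = 1" and eig: "\<And>b. b \<in> B \<Longrightarrow> \<exists>c. A *v b = c *\<^sub>R b"
    using selfadjoint_orthonormal_eigenbasis[OF matrix_vector_mul_linear sa] by blast
  obtain h :: "'n \<Rightarrow> real^'n" where h: "bij_betw h UNIV B"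
    using finite_same_card_bij[of "UNIV :: 'n set" B] B by auto
  then have hB: "h i \<in> B" for i
    by (auto simp: bij_betw_def)
  obtain d where d: "\<And>i. A *v h i = d i *\<^sub>R h i"
    using eig[OF hB] by metis
  define U :: "real^'n^'n" where "U = (\<chi> i j. h j $ i)"
  have col: "column j U = h j" for j
    by (simp add: U_def column_def vec_eq_iff)
  have orth: "orthogonal_matrix U"
    unfolding orthogonal_matrix_orthonormal_columns col
    using B(1) h hB unit by (metis UNIV_I bij_betw_imp_inj_on inj_on_def pairwise_def)
  have "A ** U = U ** diag_matrix (\<chi> i. d i)"
  proof -
    have "(A ** U) $ i $ j = (A *v h j) $ i" for i j
      by (simp add: matrix_matrix_mult_def matrix_vector_mult_def U_def)
    then show ?thesis
      by (simp add: vec_eq_iff matrix_mul_diag d) (simp add: U_def)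
  qed
  then have "U ** diag_matrix (\<chi> i. d i) ** transpose U = A"
    using orth by (metis matrix_mul_assoc matrix_mul_rid orthogonal_matrix_def)
  with orth that show thesis
    by (auto simp: spectral_decomp_def)
qed

text \<open>The matrix \<open>W = V\<^sup>T U\<close> intertwines the two diagonals, so each of its nonzero entries pairs
  equal eigenvalues and \<open>W\<close> also intertwines their images under \<open>f\<close>.\<close>

lemma spectral_decomp_map_unique:
  fixes A :: "real^'n^'n"
  assumes "spectral_decomp A U d" "spectral_decomp A V e"
  shows "U ** diag_matrix (\<chi> i. f (d $ i)) ** transpose U
       = V ** diag_matrix (\<chi> i. f (e $ i)) ** transpose V"
proof -
  define W where "W = transpose V ** U"
  have U: "transpose U ** U = mat 1" "U ** transpose U = mat 1"
    and V: "transpose V ** V = mat 1" "V ** transpose V = mat 1"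
    using assms by (auto simp: spectral_decomp_def orthogonal_matrix_def)
  have "W ** diag_matrix d = transpose V ** A ** U"
    using assms(1) U by (simp add: spectral_decomp_def W_def flip: matrix_mul_assoc)
  also have "\<dots> = diag_matrix e ** W"
    using assms(2) V by (simp add: spectral_decomp_def W_def matrix_mul_assoc)
  finally have "W $ i $ j * d $ j = e $ i * W $ i $ j" for i j
    by (metis matrix_mul_diag diag_mul_matrix)
  then have "W $ i $ j * f (d $ j) = f (e $ i) * W $ i $ j" for i j
    by (metis mult.commute mult_cancel_left)
  then have "W ** diag_matrix (\<chi> i. f (d $ i)) = diag_matrix (\<chi> i. f (e $ i)) ** W"
    by (simp add: vec_eq_iff matrix_mul_diag diag_mul_matrix)
  then have "V ** (W ** diag_matrix (\<chi> i. f (d $ i))) ** transpose U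
           = V ** (diag_matrix (\<chi> i. f (e $ i)) ** W) ** transpose U"
    by simp
  moreover have "V ** W = U"
    using V by (simp add: W_def matrix_mul_assoc)
  moreover have "W ** transpose U = transpose V"
    using U by (simp add: W_def flip: matrix_mul_assoc)
  ultimately show ?thesis
    by (metis matrix_mul_assoc)
qed

text \<open>Independence of the chosen decomposition resolves the definite description, so any
  decomposition at hand computes the power.\<close>

lemma matrix_powr_spectral_decomp:
  assumes "spectral_decomp A U d"
  shows "matrix_powr A p = U ** diag_matrix (\<chi> i. (d $ i) powr p) ** transpose U"
  unfolding matrix_powr_def
  using assms by (intro the_equality) (auto dest: spectral_decomp_map_unique[of A _ _ U d "\<lambda>x. x powr p"])

lemma trace_matrix_powr:
  assumes "spectral_decomp A U d"
  shows "trace (matrix_powr A p) = (\<Sum>i\<in>UNIV. (d $ i) powr p)"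
proof -
  have "trace (matrix_powr A p) = trace (transpose U ** U ** diag_matrix (\<chi> i. (d $ i) powr p))"
    by (simp add: matrix_powr_spectral_decomp[OF assms] trace_mul_sym[of _ "transpose U"] matrix_mul_assoc)
  also have "\<dots> = trace (diag_matrix (\<chi> i. (d $ i) powr p))"
    using assms by (simp add: spectral_decomp_def orthogonal_matrix_def)
  finally show ?thesis
    by (simp add: trace_def diag_matrix_def)
qed

text \<open>In the coordinates \<open>transpose U *v x\<close> the form is a sum of squares weighted
  by values of \<open>powr\<close>, which are nonnegative.\<close>

lemma matrix_powr_nonneg:
  assumes "spectral_decomp A U d"
  shows "0 \<le> x \<bullet> (matrix_powr A p *v x)"
proof -
  let ?D = "diag_matrix (\<chi> i. (d $ i) powr p)" and ?y = "transpose U *v x"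
  have "x \<bullet> (matrix_powr A p *v x) = ?y \<bullet> (?D *v ?y)"
    by (simp add: matrix_powr_spectral_decomp[OF assms] dot_lmul_matrix
        flip: matrix_vector_mul_assoc)
  also have "(?D *v ?y) $ i = (d $ i) powr p * ?y $ i" for i
    by (simp add: matrix_vector_mult_def diag_matrix_def if_distrib[of "\<lambda>x. x * _"] cong: if_cong)
  then have "?y \<bullet> (?D *v ?y) = (\<Sum>i\<in>UNIV. (d $ i) powr p * (?y $ i)\<^sup>2)"
    by (simp add: inner_vec_def power2_eq_square mult_ac)
  finally show ?thesis
    by (simp add: sum_nonneg)
qed

section \<open>The characteristic polynomial and the Schatten norm as a trace\<close>

lemma matrix_diff_ldistrib: "A ** (B - C) = A ** B - A ** C"
  for A :: "'a::ring_1^'n^'m"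
  by (simp add: matrix_matrix_mult_def vec_eq_iff right_diff_distrib sum_subtractf)

lemma matrix_diff_rdistrib: "(A - B) ** C = A ** C - B ** C"
  for A :: "'a::ring_1^'n^'m"
  by (simp add: matrix_matrix_mult_def vec_eq_iff left_diff_distrib sum_subtractf)

text \<open>The determinant is invariant under conjugation, carried out over the polynomial ring:
  embedding real matrices as constant ones respects products, so \<open>x I - A\<close> is the
  conjugate of a diagonal polynomial matrix.\<close>

lemma charpoly_spectral_decomp:
  fixes A :: "real^'n^'n"
  assumes "spectral_decomp A U d"
  shows "charpoly A = (\<Prod>i\<in>UNIV. [:- (d $ i), 1:])"
proof -
  define C :: "real^'n^'n \<Rightarrow> real poly^'n^'n" where "C M = (\<chi> i j. [:M $ i $ j:])" for M
  have C_mult: "C (M ** N) = C M ** C N" for M N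
    by (simp add: C_def matrix_matrix_mult_def vec_eq_iff sum_to_poly mult.commute)
  let ?D = "mat [:0, 1:] - C (diag_matrix d) :: real poly^'n^'n"
  have "C (mat 1) = mat 1"
    by (simp add: C_def mat_def vec_eq_iff one_pCons)
  then have UU: "C U ** C (transpose U) = mat 1"
    using assms by (simp add: spectral_decomp_def orthogonal_matrix_def flip: C_mult)
  \<comment> \<open>Scalar matrices are central, hence conjugation fixes \<open>x I\<close>.\<close>
  have "C U ** mat [:0, 1:] = mat [:0, 1:] ** C U"
    by (simp add: matrix_matrix_mult_def mat_def vec_eq_iff if_distrib[of "\<lambda>x. _ * x"] if_distrib[of "\<lambda>x. x * _"] mult.commute cong: if_cong)
  then have "C U ** mat [:0, 1:] ** C (transpose U) = mat [:0, 1:]"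
    using UU by (simp flip: matrix_mul_assoc)
  moreover have "C A = C U ** C (diag_matrix d) ** C (transpose U)"
    using assms by (simp add: spectral_decomp_def C_mult)
  ultimately have "mat [:0, 1:] - C A = C U ** ?D ** C (transpose U)"
    by (simp add: matrix_diff_ldistrib matrix_diff_rdistrib)
  then have "charpoly A = det (C U) * det ?D * det (C (transpose U))"
    by (simp add: charpoly_def C_def det_mul)
  also have "\<dots> = det ?D * det (C U ** C (transpose U))"
    by (simp add: det_mul)
  also have "\<dots> = det ?D"
    by (simp add: UU)
  also have "\<dots> = (\<Prod>i\<in>UNIV. ?D $ i $ i)"
    by (rule det_diagonal) (simp add: C_def mat_def diag_matrix_def)
  also have "\<dots> = (\<Prod>i\<in>UNIV. [:- (d $ i), 1:])"
    by (simp add: C_def mat_def diag_matrix_def)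
  finally show ?thesis .
qed

lemma order_prod:
  fixes f :: "'a \<Rightarrow> 'b::idom poly"
  assumes "finite I" "\<And>i. i \<in> I \<Longrightarrow> f i \<noteq> 0"
  shows "order x (\<Prod>i\<in>I. f i) = (\<Sum>i\<in>I. order x (f i))"
  using assms by (induction I rule: finite_induct) (auto simp: order_mult)

lemma order_linear_factor: "order x [:- a, 1:] = (if a = x then 1 else 0)"
  for a x :: "'a::idom"
  using order_power_n_n[of a 1] by (auto intro: order_0I)

text \<open>The order of \<open>q\<close> at \<open>x\<close> counts the indices \<open>i\<close>
  with \<open>d i = x\<close>, so grouping the indices by value turns the weighted sum over distinct
  roots into a sum over eigenvalues with repetition.\<close>

lemma sum_order_prod_linear:
  fixes d :: "'a \<Rightarrow> 'b::idom" and f :: "'b \<Rightarrow> 'c::comm_semiring_1"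
  assumes "finite I"
  defines "q \<equiv> \<Prod>i\<in>I. [:- d i, 1:]"
  shows "(\<Sum>x | poly q x = 0. of_nat (order x q) * f x) = (\<Sum>i\<in>I. f (d i))"
proof -
  have roots: "{x. poly q x = 0} = d ` I"
    using assms(1) by (auto simp: q_def poly_prod)
  have "order x q = card {i \<in> I. d i = x}" for x
    using assms(1) by (simp add: q_def order_prod order_linear_factor sum.If_cases Int_def)
  then have "(\<Sum>x | poly q x = 0. of_nat (order x q) * f x) = (\<Sum>x\<in>d ` I. \<Sum>i | i \<in> I \<and> d i = x. f (d i))"
    unfolding roots by (intro sum.cong) auto
  also have "\<dots> = (\<Sum>i\<in>I. f (d i))"
    using assms(1) by (intro sum.group) auto
  finally show ?thesis .
qed

text \<open>Connects the norm, defined through roots, with the trace, which is the mean of the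
  Gaussian quadratic form.\<close>

lemma schatten_norm_eq_trace:
  assumes "spectral_decomp A U d"
  shows "schatten_norm p A = trace (matrix_powr A p) powr (1 / p)"
  by (simp add: schatten_norm_def charpoly_spectral_decomp[OF assms] sum_order_prod_linear
      trace_matrix_powr[OF assms])

section \<open>Tools for almost sure convergence\<close>

text \<open>With \<open>k = floor_sqrt n\<close>, monotone partial sums trap the average at
  \<open>n\<close> between \<open>s (k\<^sup>2) / (k + 1)\<^sup>2\<close> and
  \<open>s ((k + 1)\<^sup>2) / k\<^sup>2\<close>. Both bounds have the limit of the subsequence
  because the ratio of consecutive squares tends to 1.\<close>

lemma average_tendsto_of_square_subsequence:
  fixes x :: "nat \<Rightarrow> real"
  assumes nonneg: "\<And>j. j \<ge> 1 \<Longrightarrow> 0 \<le> x j"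
    and sub: "(\<lambda>k. (\<Sum>j=1..k\<^sup>2. x j) / real (k\<^sup>2)) \<longlonglongrightarrow> \<mu>"
  shows "(\<lambda>n. (\<Sum>j=1..n. x j) / real n) \<longlonglongrightarrow> \<mu>"
proof -
  define s where "s n = (\<Sum>j=1..n. x j)" for n
  have s_mono: "s m \<le> s n" if "m \<le> n" for m n
    unfolding s_def using that nonneg by (intro sum_mono2) auto
  have s_nonneg: "s n \<ge> 0" for n
    unfolding s_def using nonneg by (intro sum_nonneg) auto
  have lim: "(\<lambda>k. s (k\<^sup>2) / real (k\<^sup>2)) \<longlonglongrightarrow> \<mu>"
    using sub by (simp add: s_def)
  have ratio: "(\<lambda>k. real (k\<^sup>2) / real ((Suc k)\<^sup>2)) \<longlonglongrightarrow> 1"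
    "(\<lambda>k. real ((Suc k)\<^sup>2) / real (k\<^sup>2)) \<longlonglongrightarrow> 1"
    by real_asymp+
  have lower: "(\<lambda>k. s (k\<^sup>2) / real ((Suc k)\<^sup>2)) \<longlonglongrightarrow> \<mu>"
  proof (rule Lim_transform_eventually)
    show "(\<lambda>k. s (k\<^sup>2) / real (k\<^sup>2) * (real (k\<^sup>2) / real ((Suc k)\<^sup>2))) \<longlonglongrightarrow> \<mu>"
      using tendsto_mult[OF lim ratio(1)] by simp
    show "\<forall>\<^sub>F k in sequentially. s (k\<^sup>2) / real (k\<^sup>2) * (real (k\<^sup>2) / real ((Suc k)\<^sup>2))
        = s (k\<^sup>2) / real ((Suc k)\<^sup>2)"
      using eventually_gt_at_top[of 0] by eventually_elim (simp del: of_nat_power of_nat_Suc)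
  qed
  have upper: "(\<lambda>k. s ((Suc k)\<^sup>2) / real (k\<^sup>2)) \<longlonglongrightarrow> \<mu>"
  proof (rule Lim_transform_eventually)
    show "(\<lambda>k. s ((Suc k)\<^sup>2) / real ((Suc k)\<^sup>2) * (real ((Suc k)\<^sup>2) / real (k\<^sup>2))) \<longlonglongrightarrow> \<mu>"
      using tendsto_mult[OF LIMSEQ_Suc[OF lim] ratio(2)] by simp
    show "\<forall>\<^sub>F k in sequentially. s ((Suc k)\<^sup>2) / real ((Suc k)\<^sup>2) * (real ((Suc k)\<^sup>2) / real (k\<^sup>2))
        = s ((Suc k)\<^sup>2) / real (k\<^sup>2)"
      by (intro always_eventually allI) (simp del: of_nat_power of_nat_Suc)
  qed
  have root: "filterlim floor_sqrt at_top sequentially"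
    unfolding filterlim_at_top
  proof
    fix k show "\<forall>\<^sub>F n in sequentially. k \<le> floor_sqrt n"
      using eventually_ge_at_top[of "k\<^sup>2"] by eventually_elim (simp add: le_floor_sqrtI)
  qed
  have bounds: "(floor_sqrt n)\<^sup>2 \<le> n" "n \<le> (Suc (floor_sqrt n))\<^sup>2" for n
    using Suc_floor_sqrt_power2_gt[of n] by (auto intro: less_imp_le)
  have "(\<lambda>n. s n / real n) \<longlonglongrightarrow> \<mu>"
  proof (rule tendsto_sandwich)
    show "(\<lambda>n. s ((floor_sqrt n)\<^sup>2) / real ((Suc (floor_sqrt n))\<^sup>2)) \<longlonglongrightarrow> \<mu>"
      using filterlim_compose[OF lower root] .
    show "(\<lambda>n. s ((Suc (floor_sqrt n))\<^sup>2) / real ((floor_sqrt n)\<^sup>2)) \<longlonglongrightarrow> \<mu>"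
      using filterlim_compose[OF upper root] .
    show "\<forall>\<^sub>F n in sequentially. s ((floor_sqrt n)\<^sup>2) / real ((Suc (floor_sqrt n))\<^sup>2) \<le> s n / real n"
      using eventually_gt_at_top[of 0]
    proof eventually_elim
      case (elim n)
      show ?case
        using elim bounds[of n] by (intro frac_le s_mono s_nonneg) (auto simp del: of_nat_power)
    qed
    show "\<forall>\<^sub>F n in sequentially. s n / real n \<le> s ((Suc (floor_sqrt n))\<^sup>2) / real ((floor_sqrt n)\<^sup>2)"
      \<comment> \<open>Positivity of \<open>n\<close> makes \<open>floor_sqrt n\<close> positive,
        so the larger fraction has a nonzero denominator.\<close>
      using eventually_gt_at_top[of 0]
    proof eventually_elim
      case (elim n)
      show ?case
        using elim bounds[of n] by (intro frac_le s_mono s_nonneg) (auto simp del: of_nat_power)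
    qed
  qed
  then show ?thesis
    by (simp add: s_def)
qed

text \<open>By monotone convergence the series of the \<open>f k\<close> has finite integral, so it
  converges almost everywhere and its terms tend to 0.\<close>

lemma AE_tendsto_zero_of_summable_integral:
  fixes f :: "nat \<Rightarrow> 'a \<Rightarrow> real"
  assumes int: "\<And>k. integrable M (f k)" and summable: "summable (\<lambda>k. integral\<^sup>L M (f k))"
    and nonneg: "\<And>k x. x \<in> space M \<Longrightarrow> 0 \<le> f k x"
  shows "AE x in M. (\<lambda>k. f k x) \<longlonglongrightarrow> 0"
proof -
  have [measurable]: "f k \<in> borel_measurable M" for k
    using int by blast
  have "(\<integral>\<^sup>+x. (\<Sum>k. ennreal (f k x)) \<partial>M) = (\<Sum>k. \<integral>\<^sup>+x. ennreal (f k x) \<partial>M)"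
    by (intro nn_integral_suminf) simp
  also have "\<dots> = (\<Sum>k. ennreal (integral\<^sup>L M (f k)))"
    using int nonneg by (intro suminf_cong nn_integral_eq_integral) auto
  also have "\<dots> = ennreal (\<Sum>k. integral\<^sup>L M (f k))"
    using nonneg by (intro suminf_ennreal2 summable Bochner_Integration.integral_nonneg)
  also have "\<dots> \<noteq> \<infinity>"
    by simp
  finally have "AE x in M. (\<Sum>k. ennreal (f k x)) \<noteq> \<infinity>"
    by (intro nn_integral_PInf_AE) auto
  then show ?thesis
  proof (rule AE_mp, intro AE_I2 impI)
    fix x assume "x \<in> space M" "(\<Sum>k. ennreal (f k x)) \<noteq> \<infinity>"
    then have "summable (\<lambda>k. f k x)"
      using nonneg by (intro summable_suminf_not_top) auto
    then show "(\<lambda>k. f k x) \<longlonglongrightarrow> 0"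
      by (rule summable_LIMSEQ_zero)
  qed
qed

section \<open>Uncorrelated sums and a strong law of large numbers\<close>

context prob_space
begin

text \<open>Pythagoras in the space of square integrable functions: after expanding the square only
  the diagonal terms survive.\<close>

lemma second_moment_sum_uncorrelated:
  fixes Y :: "'b \<Rightarrow> 'a \<Rightarrow> real"
  assumes I: "finite I"
    and int: "\<And>i j. i \<in> I \<Longrightarrow> j \<in> I \<Longrightarrow> integrable M (\<lambda>\<omega>. Y i \<omega> * Y j \<omega>)"
    and uncor: "\<And>i j. i \<in> I \<Longrightarrow> j \<in> I \<Longrightarrow> i \<noteq> j \<Longrightarrow> expectation (\<lambda>\<omega>. Y i \<omega> * Y j \<omega>) = 0"
  shows "integrable M (\<lambda>\<omega>. (\<Sum>i\<in>I. Y i \<omega>)\<^sup>2)"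
    and "expectation (\<lambda>\<omega>. (\<Sum>i\<in>I. Y i \<omega>)\<^sup>2) = (\<Sum>i\<in>I. expectation (\<lambda>\<omega>. (Y i \<omega>)\<^sup>2))"
proof -
  have sq: "(\<Sum>i\<in>I. Y i \<omega>)\<^sup>2 = (\<Sum>i\<in>I. \<Sum>j\<in>I. Y i \<omega> * Y j \<omega>)" for \<omega>
    by (simp add: power2_eq_square sum_product)
  show "integrable M (\<lambda>\<omega>. (\<Sum>i\<in>I. Y i \<omega>)\<^sup>2)"
    unfolding sq using int by auto
  have "expectation (\<lambda>\<omega>. (\<Sum>i\<in>I. Y i \<omega>)\<^sup>2) = (\<Sum>i\<in>I. \<Sum>j\<in>I. expectation (\<lambda>\<omega>. Y i \<omega> * Y j \<omega>))"
    unfolding sq using int by simp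
  also have "\<dots> = (\<Sum>i\<in>I. \<Sum>j\<in>I. if i = j then expectation (\<lambda>\<omega>. (Y i \<omega>)\<^sup>2) else 0)"
    by (intro sum.cong refl) (auto simp: uncor power2_eq_square)
  also have "\<dots> = (\<Sum>i\<in>I. expectation (\<lambda>\<omega>. (Y i \<omega>)\<^sup>2))"
    using I by simp
  finally show "expectation (\<lambda>\<omega>. (\<Sum>i\<in>I. Y i \<omega>)\<^sup>2) = (\<Sum>i\<in>I. expectation (\<lambda>\<omega>. (Y i \<omega>)\<^sup>2))" .
qed

lemma indep_vars_pair_expectation:
  fixes X :: "'b \<Rightarrow> 'a \<Rightarrow> real"
  assumes indep: "indep_vars (\<lambda>_. borel) X I" and ij: "i \<in> I" "j \<in> I" "i \<noteq> j"
    and int: "integrable M (X i)" "integrable M (X j)"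
  shows "integrable M (\<lambda>\<omega>. X i \<omega> * X j \<omega>)"
    and "expectation (\<lambda>\<omega>. X i \<omega> * X j \<omega>) = expectation (X i) * expectation (X j)"
proof -
  have indep2: "indep_vars (\<lambda>_. borel) X {i, j}"
    using indep_vars_subset[OF indep] ij by simp
  show "integrable M (\<lambda>\<omega>. X i \<omega> * X j \<omega>)"
    using indep_vars_integrable[OF _ indep2] int ij by auto
  show "expectation (\<lambda>\<omega>. X i \<omega> * X j \<omega>) = expectation (X i) * expectation (X j)"
    using indep_vars_lebesgue_integral[OF _ indep2] int ij by auto
qed

text \<open>Second moments make the averages converge along the squares \<open>k\<^sup>2\<close>, since the variances
  are then \<open>O(1/k\<^sup>2)\<close>; nonnegativity makes the partial sums monotone, which controls them between
  consecutive squares.\<close>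

theorem strong_law_nonneg_square_integrable:
  fixes X :: "nat \<Rightarrow> 'a \<Rightarrow> real"
  assumes indep: "indep_vars (\<lambda>_. borel) X {1..}"
    and nonneg: "\<And>j \<omega>. j \<ge> 1 \<Longrightarrow> \<omega> \<in> space M \<Longrightarrow> 0 \<le> X j \<omega>"
    and sq_int: "\<And>j. j \<ge> 1 \<Longrightarrow> integrable M (\<lambda>\<omega>. (X j \<omega>)\<^sup>2)"
    and mean: "\<And>j. j \<ge> 1 \<Longrightarrow> expectation (X j) = \<mu>"
    and bound: "\<And>j. j \<ge> 1 \<Longrightarrow> expectation (\<lambda>\<omega>. (X j \<omega>)\<^sup>2) \<le> C"
  shows "AE \<omega> in M. (\<lambda>n. (\<Sum>j=1..n. X j \<omega>) / real n) \<longlonglongrightarrow> \<mu>"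
proof -
  have X_meas: "X j \<in> borel_measurable M" if "j \<ge> 1" for j
    using indep that by (auto simp: indep_vars_def)
  have int: "integrable M (X j)" if "j \<ge> 1" for j
    using X_meas sq_int that by (blast intro: square_integrable_imp_integrable)
  define Y where "Y j \<omega> = X j \<omega> - \<mu>" for j \<omega>
  have Y_indep: "indep_vars (\<lambda>_. borel) Y {1..}"
    unfolding Y_def using indep by (rule indep_vars_compose2) simp
  have Y_int: "integrable M (Y j)" and Y_mean: "expectation (Y j) = 0" if "j \<ge> 1" for j
    using int[OF that] mean[OF that] by (simp_all add: Y_def[abs_def] prob_space)
  have Y_sq_int: "integrable M (\<lambda>\<omega>. (Y j \<omega>)\<^sup>2)" if "j \<ge> 1" for j
    using sq_int[OF that] int[OF that] by (simp add: Y_def power2_diff)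
  have Y_sq: "expectation (\<lambda>\<omega>. (Y j \<omega>)\<^sup>2) \<le> C" if "j \<ge> 1" for j
  proof -
    have "expectation (\<lambda>\<omega>. (Y j \<omega>)\<^sup>2) = expectation (\<lambda>\<omega>. (X j \<omega>)\<^sup>2) - \<mu>\<^sup>2"
      using variance_eq[OF int[OF that] sq_int[OF that]] mean[OF that] by (simp add: Y_def)
    also have "\<dots> \<le> C"
      using bound[OF that] zero_le_power2[of \<mu>] by linarith
    finally show ?thesis .
  qed
  have cross_int: "integrable M (\<lambda>\<omega>. Y i \<omega> * Y j \<omega>)" if "i \<ge> 1" "j \<ge> 1" for i j
  proof (cases "i = j")
    case True
    then show ?thesis
      using Y_sq_int that by (simp add: power2_eq_square)
  next
    case False
    then show ?thesis
      using indep_vars_pair_expectation(1)[OF Y_indep] Y_int that by simp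
  qed
  have cross_zero: "expectation (\<lambda>\<omega>. Y i \<omega> * Y j \<omega>) = 0" if "i \<ge> 1" "j \<ge> 1" "i \<noteq> j" for i j
    using indep_vars_pair_expectation(2)[OF Y_indep, of i j] Y_int Y_mean that by simp
  \<comment> \<open>The squared deviation from \<open>\<mu>\<close> of the average of the first
    \<open>k\<^sup>2\<close> variables. Its expectation is at most \<open>C / k\<^sup>2\<close>,
    which is summable.\<close>
  define D where "D k \<omega> = ((\<Sum>j=1..k\<^sup>2. Y j \<omega>) / real (k\<^sup>2))\<^sup>2" for k \<omega>
  have D_alt: "D k \<omega> = (\<Sum>j=1..k\<^sup>2. Y j \<omega>)\<^sup>2 / (real (k\<^sup>2))\<^sup>2" for k \<omega>
    by (simp add: D_def power_divide)
  have D_int: "integrable M (D k)" for k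
    unfolding D_alt[abs_def]
    using second_moment_sum_uncorrelated(1)[of "{1..k\<^sup>2}" Y] cross_int cross_zero by simp
  have D_bound: "expectation (D k) \<le> C * (1 / real k ^ 2)" for k
  proof -
    have "expectation (D k) = (\<Sum>j=1..k\<^sup>2. expectation (\<lambda>\<omega>. (Y j \<omega>)\<^sup>2)) / (real (k\<^sup>2))\<^sup>2"
      unfolding D_alt[abs_def]
      using second_moment_sum_uncorrelated(2)[of "{1..k\<^sup>2}" Y] cross_int cross_zero by simp
    also have "\<dots> \<le> (\<Sum>j=1..k\<^sup>2. C) / (real (k\<^sup>2))\<^sup>2"
      using Y_sq by (intro divide_right_mono sum_mono) auto
    also have "\<dots> = C * (1 / real k ^ 2)"
      \<comment> \<open>At \<open>k = 0\<close> both sides are 0, since division by zero yields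
        0.\<close>
      by (cases "k = 0") (simp_all add: field_simps power2_eq_square)
    finally show ?thesis .
  qed
  have "summable (\<lambda>k. expectation (D k))"
  proof (rule summable_comparison_test')
    show "summable (\<lambda>k. C * (1 / real k ^ 2))"
      using inverse_power_summable[of 2, where 'a = real]
      by (intro summable_mult) (simp add: field_simps)
    show "norm (expectation (D k)) \<le> C * (1 / real k ^ 2)" for k
      using D_bound[of k] by (simp add: D_def[abs_def] integral_nonneg_AE)
  qed
  with D_int have "AE \<omega> in M. (\<lambda>k. D k \<omega>) \<longlonglongrightarrow> 0"
    by (rule AE_tendsto_zero_of_summable_integral) (simp add: D_def)
  then show ?thesis
  proof (rule AE_mp, intro AE_I2 impI)
    fix \<omega> assume \<omega>: "\<omega> \<in> space M" "(\<lambda>k. D k \<omega>) \<longlonglongrightarrow> 0"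
    have "(\<lambda>k. \<bar>(\<Sum>j=1..k\<^sup>2. Y j \<omega>) / real (k\<^sup>2)\<bar>) \<longlonglongrightarrow> 0"
      using tendsto_real_sqrt[OF \<omega>(2)] by (simp only: D_def real_sqrt_abs real_sqrt_zero)
    then have "(\<lambda>k. (\<Sum>j=1..k\<^sup>2. Y j \<omega>) / real (k\<^sup>2)) \<longlonglongrightarrow> 0"
      by (rule tendsto_rabs_zero_cancel)
    then have "(\<lambda>k. (\<Sum>j=1..k\<^sup>2. Y j \<omega>) / real (k\<^sup>2) + \<mu>) \<longlonglongrightarrow> \<mu>"
      by (auto intro: tendsto_eq_intros)
    then have "(\<lambda>k. (\<Sum>j=1..k\<^sup>2. X j \<omega>) / real (k\<^sup>2)) \<longlonglongrightarrow> \<mu>"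
    proof (rule Lim_transform_eventually)
      \<comment> \<open>Only eventually: at \<open>k = 0\<close> the left side is
        \<open>\<mu>\<close> and the right side is 0.\<close>
      show "\<forall>\<^sub>F k in sequentially. (\<Sum>j=1..k\<^sup>2. Y j \<omega>) / real (k\<^sup>2) + \<mu> = (\<Sum>j=1..k\<^sup>2. X j \<omega>) / real (k\<^sup>2)"
        using eventually_gt_at_top[of 0]
        by eventually_elim (simp add: Y_def sum_subtractf field_simps)
    qed
    then show "(\<lambda>n. (\<Sum>j=1..n. X j \<omega>) / real n) \<longlonglongrightarrow> \<mu>"
      using nonneg \<omega>(1) by (intro average_tendsto_of_square_subsequence) auto
  qed
qed

section \<open>Moments of Gaussian quadratic forms\<close>

text \<open>The values come from the integrals of powers against the normal density. The fourth
  moment controls the square of a quadratic form.\<close>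

lemma std_normal_moments:
  assumes D: "distributed M lborel X std_normal_density"
  shows "integrable M (\<lambda>\<omega>. X \<omega> ^ k)"
    and "expectation X = 0" and "expectation (\<lambda>\<omega>. (X \<omega>)\<^sup>2) = 1" and "expectation (\<lambda>\<omega>. X \<omega> ^ 4) = 3"
proof -
  have E: "expectation (\<lambda>\<omega>. X \<omega> ^ k) = (\<integral>x. std_normal_density x * x ^ k \<partial>lborel)" for k
    using distributed_integral[OF D, of "\<lambda>x. x ^ k"] by simp
  show "integrable M (\<lambda>\<omega>. X \<omega> ^ k)"
    using distributed_integrable[OF D, of "\<lambda>x. x ^ k"] integrable_std_normal_moment by simp
  show "expectation X = 0"
    using E[of 1] integral_std_normal_moment_odd[of 0] by simp
  show "expectation (\<lambda>\<omega>. (X \<omega>)\<^sup>2) = 1"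
    using E[of 2] integral_std_normal_moment_even[of 1] by (simp add: fact_numeral)
  show "expectation (\<lambda>\<omega>. X \<omega> ^ 4) = 3"
    using E[of 4] integral_std_normal_moment_even[of 2] by (simp add: fact_numeral)
qed

lemma std_gaussian_vector_measurable:
  assumes "std_gaussian_vector (X :: 'a \<Rightarrow> real^'n)"
  shows "X \<in> borel_measurable M"
proof (rule borel_measurable_euclidean_space[THEN iffD2], intro ballI)
  fix b :: "real^'n" assume "b \<in> Basis"
  then obtain i where "b = axis i 1"
    by (auto simp: Basis_vec_def)
  moreover have "(\<lambda>\<omega>. X \<omega> $ i) \<in> borel_measurable M"
    using assms by (auto simp: std_gaussian_vector_def indep_vars_def)
  ultimately show "(\<lambda>\<omega>. X \<omega> \<bullet> b) \<in> borel_measurable M"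
    by (simp add: inner_axis)
qed

text \<open>The second-moment matrix of the coordinates is the identity, so only the diagonal of
  \<open>B\<close> contributes.\<close>

lemma std_gaussian_vector_expectation_quadratic_form:
  assumes X: "std_gaussian_vector (X :: 'a \<Rightarrow> real^'n)"
  shows "expectation (\<lambda>\<omega>. X \<omega> \<bullet> (B *v X \<omega>)) = trace B"
proof -
  have indep: "indep_vars (\<lambda>_. borel) (\<lambda>i \<omega>. X \<omega> $ i) UNIV"
    and D: "distributed M lborel (\<lambda>\<omega>. X \<omega> $ i) std_normal_density" for i
    using X by (auto simp: std_gaussian_vector_def)
  note int = std_normal_moments(1)[OF D]
  have cross: "integrable M (\<lambda>\<omega>. X \<omega> $ i * X \<omega> $ j) \<and>
      expectation (\<lambda>\<omega>. X \<omega> $ i * X \<omega> $ j) = (if i = j then 1 else 0)" for i j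
  proof (cases "i = j")
    case True
    then show ?thesis
      using int[of j 2] std_normal_moments(3)[OF D] by (simp add: power2_eq_square)
  next
    case False
    then show ?thesis
      using indep_vars_pair_expectation[OF indep, of i j] int[of _ 1] std_normal_moments(2)[OF D] by simp
  qed
  have "X \<omega> \<bullet> (B *v X \<omega>) = (\<Sum>i\<in>UNIV. \<Sum>j\<in>UNIV. B $ i $ j * (X \<omega> $ i * X \<omega> $ j))" for \<omega>
    by (simp add: inner_vec_def matrix_vector_mult_def sum_distrib_left mult_ac)
  then have "expectation (\<lambda>\<omega>. X \<omega> \<bullet> (B *v X \<omega>)) = (\<Sum>i\<in>UNIV. \<Sum>j\<in>UNIV. B $ i $ j * (if i = j then 1 else 0))"
    using cross by simp
  also have "\<dots> = trace B"
    by (simp add: trace_def if_distrib cong: if_cong)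
  finally show ?thesis .
qed

text \<open>The form is at most \<open>K\<close> times the squared norm of the vector, with
  \<open>K\<close> the operator norm of \<open>B\<close>, and Cauchy-Schwarz bounds the fourth power
  of the norm by the dimension times the sum of fourth powers of the coordinates. The bound depends
  on \<open>B\<close> and the dimension alone, so it is uniform over the samples.\<close>

lemma std_gaussian_vector_square_quadratic_form:
  assumes X: "std_gaussian_vector (X :: 'a \<Rightarrow> real^'n)"
  shows "integrable M (\<lambda>\<omega>. (X \<omega> \<bullet> (B *v X \<omega>))\<^sup>2)"
    and "expectation (\<lambda>\<omega>. (X \<omega> \<bullet> (B *v X \<omega>))\<^sup>2) \<le> 3 * (onorm ((*v) B) * real CARD('n))\<^sup>2"
proof -
  note [measurable] = std_gaussian_vector_measurable[OF X]
  have D: "distributed M lborel (\<lambda>\<omega>. X \<omega> $ i) std_normal_density" for i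
    using X by (auto simp: std_gaussian_vector_def)
  have [measurable]: "(*v) B \<in> borel_measurable borel"
    by (intro borel_measurable_continuous_onI linear_continuous_on matrix_vector_mul_bounded_linear)
  define K where "K = onorm ((*v) B)"
  define R where "R \<omega> = K\<^sup>2 * ((\<Sum>i\<in>UNIV. X \<omega> $ i ^ 4) * real CARD('n))" for \<omega>
  have le: "(X \<omega> \<bullet> (B *v X \<omega>))\<^sup>2 \<le> R \<omega>" for \<omega>
  proof -
    have "\<bar>X \<omega> \<bullet> (B *v X \<omega>)\<bar> \<le> norm (X \<omega>) * norm (B *v X \<omega>)"
      by (rule Cauchy_Schwarz_ineq2)
    also have "\<dots> \<le> norm (X \<omega>) * (K * norm (X \<omega>))"
      unfolding K_def by (intro mult_left_mono onorm) (auto intro: matrix_vector_mul_bounded_linear)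
    also have "\<dots> = K * (\<Sum>i\<in>UNIV. (X \<omega> $ i)\<^sup>2)"
      by (simp add: norm_vec_def L2_set_def sum_nonneg)
    finally have "(X \<omega> \<bullet> (B *v X \<omega>))\<^sup>2 \<le> (K * (\<Sum>i\<in>UNIV. (X \<omega> $ i)\<^sup>2))\<^sup>2"
      by (simp add: power2_le_iff_abs_le abs_le_square_iff order_trans[OF abs_ge_zero])
    also have "\<dots> \<le> R \<omega>"
      unfolding power_mult_distrib R_def
      using sum_squared_le_sum_of_squares[of "\<lambda>i. (X \<omega> $ i)\<^sup>2" UNIV]
      by (intro mult_left_mono) auto
    finally show ?thesis .
  qed
  have R_int: "integrable M R"
    unfolding R_def[abs_def] using std_normal_moments(1)[OF D] by simp
  show int: "integrable M (\<lambda>\<omega>. (X \<omega> \<bullet> (B *v X \<omega>))\<^sup>2)"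
  proof (rule Bochner_Integration.integrable_bound[OF R_int])
    show "(\<lambda>\<omega>. (X \<omega> \<bullet> (B *v X \<omega>))\<^sup>2) \<in> borel_measurable M"
      by measurable
    show "AE \<omega> in M. norm ((X \<omega> \<bullet> (B *v X \<omega>))\<^sup>2) \<le> norm (R \<omega>)"
      using le by (intro AE_I2) (simp add: order_trans[OF le abs_ge_self])
  qed
  have "expectation (\<lambda>\<omega>. (X \<omega> \<bullet> (B *v X \<omega>))\<^sup>2) \<le> expectation R"
    using int R_int le by (intro integral_mono) auto
  \<comment> \<open>Each coordinate contributes its fourth moment 3; one factor
    \<open>CARD('n)\<close> counts the coordinates, the other stems from Cauchy-Schwarz.\<close>
  also have "\<dots> = 3 * (K * real CARD('n))\<^sup>2"
    unfolding R_def[abs_def] using std_normal_moments(1,4)[OF D]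
    by (simp add: power2_eq_square)
  finally show "expectation (\<lambda>\<omega>. (X \<omega> \<bullet> (B *v X \<omega>))\<^sup>2) \<le> 3 * (onorm ((*v) B) * real CARD('n))\<^sup>2"
    by (simp add: K_def)
qed

end

section \<open>Almost sure convergence of the estimator\<close>

theorem proposition4:
  fixes A :: "real^'n^'n" and p :: real
    and P :: "'w measure" and w :: "nat \<Rightarrow> 'w \<Rightarrow> real^'n"
  assumes "pos_semidef A"
    and "p \<ge> 1"
    and "prob_space P"
    and "prob_space.indep_vars P (\<lambda>_. borel) w {1..}"
    and "\<And>j. j \<ge> 1 \<Longrightarrow> prob_space.std_gaussian_vector P (w j)"
  shows "AE \<omega> in P.
    (\<lambda>M. (1 / real M * (\<Sum>j = 1..M. w j \<omega> \<bullet> (matrix_powr A p *v w j \<omega>))) powr (1 / p))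
      \<longlonglongrightarrow> schatten_norm p A"
proof -
  interpret prob_space P
    by (rule assms(3))
  obtain U d where U: "spectral_decomp A U d"
    using assms(1) spectral_decomp_exists[of A] by (auto simp: pos_semidef_def)
  define B where "B = matrix_powr A p"
  define X where "X j \<omega> = w j \<omega> \<bullet> (B *v w j \<omega>)" for j \<omega>
  have X_nonneg: "0 \<le> X j \<omega>" for j \<omega>
    by (simp add: X_def B_def matrix_powr_nonneg[OF U])
  \<comment> \<open>One fixed Borel function is applied to every sample, which preserves
    independence.\<close>
  have "(\<lambda>x. x \<bullet> (B *v x)) \<in> borel_measurable borel"
    by (intro borel_measurable_continuous_onI continuous_intros linear_continuous_on
        matrix_vector_mul_bounded_linear)
  then have "indep_vars (\<lambda>_. borel) X {1..}"
    unfolding X_def by (rule indep_vars_compose2[OF assms(4)])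
  then have "AE \<omega> in P. (\<lambda>M. (\<Sum>j=1..M. X j \<omega>) / real M) \<longlonglongrightarrow> trace B"
    using X_nonneg assms(5) unfolding X_def
    by (intro strong_law_nonneg_square_integrable[where C = "3 * (onorm ((*v) B) * real CARD('n))\<^sup>2"]
        std_gaussian_vector_square_quadratic_form
        std_gaussian_vector_expectation_quadratic_form)
  then show ?thesis
  proof (rule AE_mp, intro AE_I2 impI)
    fix \<omega>
    assume "(\<lambda>M. (\<Sum>j=1..M. X j \<omega>) / real M) \<longlonglongrightarrow> trace B"
    \<comment> \<open>The limit \<open>trace B\<close> may be 0, where continuity of
      \<open>powr\<close> relies on the positive exponent \<open>1 / p\<close> and on nonnegative
      averages.\<close>
    then have "(\<lambda>M. ((\<Sum>j=1..M. X j \<omega>) / real M) powr (1 / p)) \<longlonglongrightarrow> trace B powr (1 / p)"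
      using assms(2) X_nonneg
      by (intro tendsto_powr') (auto intro!: always_eventually sum_nonneg divide_nonneg_nonneg)
    then show "(\<lambda>M. (1 / real M * (\<Sum>j = 1..M. w j \<omega> \<bullet> (matrix_powr A p *v w j \<omega>))) powr (1 / p))
        \<longlonglongrightarrow> schatten_norm p A"
      by (simp add: X_def B_def schatten_norm_eq_trace[OF U])
  qed
qed

end
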